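(* For every non-negative integer $n$ and every integer $s$, \[ 2\sum_{k = 0}^{\lfloor n/2 \rfloor} \binom {n}{2k} \frac{F_{6k + s}}{9^k} = \left(\frac23\right)^{n} \begin{cases} (-1)^{s+1} F_{n - s} + 5^{n/2}F_{n+s}, & \text{$n$ even;}\\ (-1)^{s+1} F_{n - s} + 5^{(n-1)/2}L_{n+s}, & \text{$n$ odd,} \end{cases} \] \[ 2\sum_{ k = 0}^{\lfloor n/2 \rfloor} \binom {n}{2k} \frac{L_{6k + s}}{9^k} =\left(\frac23\right)^{n} \begin{cases} (-1)^s L_{n - s} + 5^{n/2}L_{n+s}, & \text{$n$ even;}\\ (-1)^s L_{n - s} + 5^{(n+1)/2}F_{n+s}, & \text{$n$ odd.} \end{cases} \]
   Context: The Fibonacci numbers $F_j$ and Lucas numbers $L_j$ are defined for all integers $j$ by $F_0=0$, $F_1=1$, $L_0=2$, $L_1=1$, $F_j=F_{j-1}+F_{j-2}$, $L_j=L_{j-1}+L_{j-2}$, with $F_{-j}=(-1)^{j-1}F_j$ and $L_{-j}=(-1)^jL_j$. *)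

theory Defs
  imports Complex_Main "HOL-Number_Theory.Fib"
begin

fun lucas_nat :: "nat \<Rightarrow> nat" where
  "lucas_nat 0 = 2"
| "lucas_nat (Suc 0) = 1"
| "lucas_nat (Suc (Suc n)) = lucas_nat (Suc n) + lucas_nat n"

text \<open>
  Extension to all integer indices by \<open>F\<^bsub>-j\<^esub> = (-1)\<^bsup>j-1\<^esup> F\<^bsub>j\<^esub>\<close> and \<open>L\<^bsub>-j\<^esub> = (-1)\<^bsup>j\<^esup> L\<^bsub>j\<^esub>\<close>.
  In the second branch \<open>nat (-j) \<ge> 1\<close>, so the subtraction on \<^typ>\<open>nat\<close> does not truncate.
\<close>

definition fibonacci :: "int \<Rightarrow> int" where
  "fibonacci j =
     (if 0 \<le> j then int (fib (nat j))
      else (-1) ^ (nat (-j) - 1) * int (fib (nat (-j))))"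

definition lucas :: "int \<Rightarrow> int" where
  "lucas j =
     (if 0 \<le> j then int (lucas_nat (nat j))
      else (-1) ^ nat (-j) * int (lucas_nat (nat (-j))))"

lemma fibonacci_initial: "fibonacci 0 = 0" "fibonacci 1 = 1"
  by (simp_all add: fibonacci_def)

lemma lucas_initial: "lucas 0 = 2" "lucas 1 = 1"
  by (simp_all add: lucas_def)

lemma fibonacci_minus: "fibonacci (- j) = (-1) ^ nat \<bar>j - 1\<bar> * fibonacci j"
  by (cases "even j")
     (auto simp: fibonacci_def minus_one_power_iff even_nat_iff abs_if nat_diff_distrib)

lemma lucas_minus: "lucas (- j) = (-1) ^ nat \<bar>j\<bar> * lucas j"
  by (auto simp: lucas_def minus_one_power_iff even_nat_iff)

lemma fibonacci_rec: "fibonacci j = fibonacci (j - 1) + fibonacci (j - 2)"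
proof -
  consider n where "j = int n + 2" | "j = 1" | "j = 0" | n where "j = - int n - 1"
  proof -
    assume a: "\<And>n. j = int n + 2 \<Longrightarrow> thesis" "j = 1 \<Longrightarrow> thesis" "j = 0 \<Longrightarrow> thesis"
      "\<And>n. j = - int n - 1 \<Longrightarrow> thesis"
    show thesis using a(1)[of "nat (j - 2)"] a(2,3) a(4)[of "nat (- j - 1)"] by linarith
  qed
  then show ?thesis
  proof cases
    case (1 n)
    then have "nat j = Suc (Suc n)" "nat (j - 1) = Suc n" "nat (j - 2) = n" by auto
    with 1 show ?thesis by (simp add: fibonacci_def)
  next
    case (4 n)
    then have "nat (- j) = Suc n" "nat (- (j - 1)) = Suc (Suc n)"
      "nat (- (j - 2)) = Suc (Suc (Suc n))" by auto
    with 4 show ?thesis unfolding fibonacci_def by (simp add: algebra_simps)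
  qed (simp_all add: fibonacci_def numeral_2_eq_2)
qed

lemma lucas_rec: "lucas j = lucas (j - 1) + lucas (j - 2)"
proof -
  consider n where "j = int n + 2" | "j = 1" | "j = 0" | n where "j = - int n - 1"
  proof -
    assume a: "\<And>n. j = int n + 2 \<Longrightarrow> thesis" "j = 1 \<Longrightarrow> thesis" "j = 0 \<Longrightarrow> thesis"
      "\<And>n. j = - int n - 1 \<Longrightarrow> thesis"
    show thesis using a(1)[of "nat (j - 2)"] a(2,3) a(4)[of "nat (- j - 1)"] by linarith
  qed
  then show ?thesis
  proof cases
    case (1 n)
    then have "nat j = Suc (Suc n)" "nat (j - 1) = Suc n" "nat (j - 2) = n" by auto
    with 1 show ?thesis by (simp add: lucas_def)
  next
    case (4 n)
    then have "nat (- j) = Suc n" "nat (- (j - 1)) = Suc (Suc n)"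
      "nat (- (j - 2)) = Suc (Suc (Suc n))" by auto
    with 4 show ?thesis unfolding lucas_def by (simp add: algebra_simps)
  qed (simp_all add: lucas_def numeral_2_eq_2)
qed

end

theory Submission
  imports Defs
begin

text \<open>
  Let \<open>x\<close> be a root of \<open>x\<^sup>2 = x + 1\<close>, let \<open>y = 1 - x\<close> be the other root and \<open>r = 2 x - 1 = \<plusminus>\<surd>5\<close> their
  difference. Since \<open>x\<^sup>3 = 2 x + 1\<close>, we have \<open>1 + x\<^sup>3/3 = (2/3) r x\<close> and \<open>1 - x\<^sup>3/3 = (2/3) y\<close>, so
  adding the binomial expansions of \<open>(1 + x\<^sup>3/3)\<^sup>n\<close> and \<open>(1 - x\<^sup>3/3)\<^sup>n\<close> evaluates the sum with
  \<open>x\<^bsup>6k+s\<^esup>\<close> in place of \<open>F\<^bsub>6k+s\<^esub>\<close>. Binet's formulas then give both identities.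
\<close>

text \<open>The terms of odd degree cancel between the expansions at \<open>x\<close> and
  \<open>- x\<close>, while those of even degree double; the even indices are then written as
  \<open>2 * k\<close>.\<close>

lemma sum_even_choose_power:
  fixes x :: real
  shows "2 * (\<Sum>k = 0..n div 2. real (n choose (2 * k)) * x ^ (2 * k)) = (1 + x) ^ n + (1 - x) ^ n"
proof -
  have "(1 + x) ^ n + (1 - x) ^ n = (\<Sum>i\<le>n. real (n choose i) * (x ^ i + (- x) ^ i))"
    using binomial_ring[of x 1 n] binomial_ring[of "- x" 1 n]
    by (simp add: sum.distrib algebra_simps)
  also have "\<dots> = (\<Sum>i\<in>{i. i \<le> n \<and> even i}. 2 * (real (n choose i) * x ^ i))"
    by (rule sum.mono_neutral_cong_right) auto
  also have "\<dots> = (\<Sum>k = 0..n div 2. 2 * (real (n choose (2 * k)) * x ^ (2 * k)))"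
    by (rule sum.reindex_bij_witness[of _ "\<lambda>k. 2 * k" "\<lambda>i. i div 2"]) auto
  finally show ?thesis
    by (simp add: sum_distrib_left)
qed

text \<open>A second-order recurrence can be run in both directions, so two adjacent values fix the
  whole sequence. This yields Binet's formulas at all integer indices without a case split on the
  sign.\<close>

lemma fibonacci_like_unique:
  fixes f g :: "int \<Rightarrow> real"
  assumes f: "\<And>j. f j = f (j - 1) + f (j - 2)" and g: "\<And>j. g j = g (j - 1) + g (j - 2)"
    and "f 0 = g 0" "f 1 = g 1"
  shows "f j = g j"
proof -
  \<comment> \<open>Carrying two neighbouring values lets the recurrence at \<open>i + 2\<close>
    move the pair up and the recurrence at \<open>i + 1\<close>, solved for its last term, move it
    down.\<close>
  have "f j = g j \<and> f (j + 1) = g (j + 1)"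
  proof (induction j rule: int_induct[where k = 0])
    case base
    show ?case using assms(3,4) by simp
  next
    case (step1 i)
    then show ?case using f[of "i + 2"] g[of "i + 2"] by (simp add: algebra_simps)
  next
    case (step2 i)
    then show ?case using f[of "i + 1"] g[of "i + 1"] by (simp add: algebra_simps)
  qed
  then show ?thesis by simp
qed

lemma golden_powi_rec:
  fixes x :: real
  assumes "x\<^sup>2 = x + 1"
  shows "x powi j = x powi (j - 1) + x powi (j - 2)"
proof -
  have x: "x \<noteq> 0" using assms by auto
  have "x powi j = x powi (j - 2) * x\<^sup>2"
    using power_int_add[of x "j - 2" 2] x by simp
  also have "\<dots> = x powi (j - 2) * x + x powi (j - 2)"
    by (simp add: assms algebra_simps)
  also have "x powi (j - 2) * x = x powi (j - 1)"
    using power_int_add_1[of x "j - 2"] x by (simp add: algebra_simps)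
  finally show ?thesis .
qed

context
  fixes \<alpha> \<beta> :: real
  defines "\<alpha> \<equiv> (1 + sqrt 5) / 2" and "\<beta> \<equiv> (1 - sqrt 5) / 2"
begin

lemma golden_roots: "\<alpha>\<^sup>2 = \<alpha> + 1" "\<beta>\<^sup>2 = \<beta> + 1"
  by (simp_all add: \<alpha>_def \<beta>_def power2_eq_square field_simps)

text \<open>Both sides satisfy the Fibonacci recurrence and agree at 0 and 1. The factor
  \<open>sqrt 5\<close> stays on the left to avoid division.\<close>

lemma fibonacci_binet: "sqrt 5 * real_of_int (fibonacci j) = \<alpha> powi j - \<beta> powi j"
proof (rule fibonacci_like_unique)
  fix j
  show "sqrt 5 * real_of_int (fibonacci j) =
      sqrt 5 * real_of_int (fibonacci (j - 1)) + sqrt 5 * real_of_int (fibonacci (j - 2))"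
    by (subst fibonacci_rec) (simp add: algebra_simps)
  show "\<alpha> powi j - \<beta> powi j =
      (\<alpha> powi (j - 1) - \<beta> powi (j - 1)) + (\<alpha> powi (j - 2) - \<beta> powi (j - 2))"
    using golden_roots[THEN golden_powi_rec, of j] by simp
qed (simp_all add: fibonacci_initial \<alpha>_def \<beta>_def field_simps)

lemma lucas_binet: "real_of_int (lucas j) = \<alpha> powi j + \<beta> powi j"
proof (rule fibonacci_like_unique)
  fix j
  show "real_of_int (lucas j) = real_of_int (lucas (j - 1)) + real_of_int (lucas (j - 2))"
    by (subst lucas_rec) simp
  show "\<alpha> powi j + \<beta> powi j =
      (\<alpha> powi (j - 1) + \<beta> powi (j - 1)) + (\<alpha> powi (j - 2) + \<beta> powi (j - 2))"
    using golden_roots[THEN golden_powi_rec, of j] by simp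
qed (simp_all add: lucas_initial \<alpha>_def \<beta>_def field_simps)

end

text \<open>This is \<open>sum_even_choose_power\<close> at \<open>x ^ 3 / 3\<close>. Keeping the
  root \<open>x\<close> arbitrary covers \<alpha> and \<beta> at once.\<close>

lemma sum_even_choose_golden_powi:
  fixes x :: real
  assumes x2: "x\<^sup>2 = x + 1"
  shows "2 * (\<Sum>k = 0..n div 2. real (n choose (2 * k)) * (x powi (6 * int k + s) / 9 ^ k)) =
    (2 / 3) ^ n * ((2 * x - 1) ^ n * x powi (int n + s) + (-1) powi s * (1 - x) powi (int n - s))"
proof -
  have x: "x \<noteq> 0" and y: "1 - x \<noteq> 0" using x2 by auto
  have cube: "x ^ 3 = 2 * x + 1"
    using x2 by (simp add: power3_eq_cube power2_eq_square algebra_simps)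
  have plus: "1 + x ^ 3 / 3 = 2 / 3 * ((2 * x - 1) * x)"
  proof -
    have "(2 * x - 1) * x = 2 * x\<^sup>2 - x"
      by (simp add: power2_eq_square algebra_simps)
    also have "\<dots> = x + 2"
      by (simp add: x2)
    finally show ?thesis
      unfolding cube by simp
  qed
  have minus: "1 - x ^ 3 / 3 = 2 / 3 * (1 - x)"
    by (simp add: cube algebra_simps)
  \<comment> \<open>The factor \<open>x powi s\<close> is free of \<open>k\<close> and leaves the
    sum; what remains is an even power of \<open>x ^ 3 / 3\<close>.\<close>
  have "x powi (6 * int k + s) / 9 ^ k = (x ^ 3 / 3) ^ (2 * k) * x powi s" for k
  proof -
    have "x powi (6 * int k + s) = x ^ (6 * k) * x powi s"
      using x power_int_add[of x "int (6 * k)" s] by (simp only: power_int_of_nat) simp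
    moreover have "(x ^ 3 / 3) ^ (2 * k) = x ^ (6 * k) / 9 ^ k"
    proof -
      have "(x ^ 3 / 3)\<^sup>2 = x ^ 6 / 9"
        by (simp add: power_divide flip: power_mult)
      then show ?thesis
        by (simp only: power_mult power_divide)
    qed
    ultimately show ?thesis by simp
  qed
  then have "2 * (\<Sum>k = 0..n div 2. real (n choose (2 * k)) * (x powi (6 * int k + s) / 9 ^ k)) =
      2 * (\<Sum>k = 0..n div 2. real (n choose (2 * k)) * (x ^ 3 / 3) ^ (2 * k)) * x powi s"
    by (simp add: sum_distrib_right mult.assoc)
  also have "\<dots> = (2 / 3) ^ n * ((2 * x - 1) ^ n * (x ^ n * x powi s) + (1 - x) ^ n * x powi s)"
    unfolding sum_even_choose_power plus minus power_mult_distrib by (simp add: algebra_simps)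
  also have "x ^ n * x powi s = x powi (int n + s)"
    using x by (simp add: power_int_add)
  also have "(1 - x) ^ n * x powi s = (-1) powi s * (1 - x) powi (int n - s)"
  proof -
    \<comment> \<open>The two roots have product -1, so \<open>x powi s\<close> becomes a power of
      the other root with exponent \<open>- s\<close>. This is the source of the index
      \<open>n - s\<close> and of the sign.\<close>
    have "x = (-1) * inverse (1 - x)"
      using x2 y by (simp add: field_simps power2_eq_square)
    then have "x powi s = (-1) powi s * inverse ((1 - x) powi s)"
      by (metis power_int_inverse power_int_mult_distrib)
    then show ?thesis
      using y by (simp add: power_int_diff field_simps)
  qed
  finally show ?thesis .
qed

theorem theorem13:
  fixes n :: nat and s :: int
  shows "2 * (\<Sum>k = 0..n div 2. real (n choose (2 * k)) *
              (real_of_int (fibonacci (6 * int k + s)) / 9 ^ k)) =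
         (2 / 3) ^ n *
           (if even n
            then (-1) powi (s + 1) * real_of_int (fibonacci (int n - s))
                   + 5 ^ (n div 2) * real_of_int (fibonacci (int n + s))
            else (-1) powi (s + 1) * real_of_int (fibonacci (int n - s))
                   + 5 ^ ((n - 1) div 2) * real_of_int (lucas (int n + s)))
       \<and>
         2 * (\<Sum>k = 0..n div 2. real (n choose (2 * k)) *
              (real_of_int (lucas (6 * int k + s)) / 9 ^ k)) =
         (2 / 3) ^ n *
           (if even n
            then (-1) powi s * real_of_int (lucas (int n - s))
                   + 5 ^ (n div 2) * real_of_int (lucas (int n + s))
            else (-1) powi s * real_of_int (lucas (int n - s))
                   + 5 ^ ((n + 1) div 2) * real_of_int (fibonacci (int n + s)))"
proof -
  define \<alpha> \<beta> :: real where "\<alpha> = (1 + sqrt 5) / 2" and "\<beta> = (1 - sqrt 5) / 2"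
  note defs = \<alpha>_def \<beta>_def
  have rel: "2 * \<alpha> - 1 = sqrt 5" "1 - \<alpha> = \<beta>" "2 * \<beta> - 1 = - sqrt 5" "1 - \<beta> = \<alpha>"
    by (simp_all add: defs field_simps)
  define S where
    "S x = 2 * (\<Sum>k = 0..n div 2. real (n choose (2 * k)) * (x powi (6 * int k + s) / 9 ^ k))"
    for x :: real
  define u v where "u = (-1 :: real) powi s" and "v = (2 / 3 :: real) ^ n"
  note F = fibonacci_binet[folded defs] and L = lucas_binet[folded defs]
  have S\<alpha>: "S \<alpha> = v * (sqrt 5 ^ n * \<alpha> powi (int n + s) + u * \<beta> powi (int n - s))"
    using sum_even_choose_golden_powi[OF golden_roots(1), folded defs, of n s]
    unfolding S_def u_def v_def rel .
  have S\<beta>: "S \<beta> = v * ((- sqrt 5) ^ n * \<beta> powi (int n + s) + u * \<alpha> powi (int n - s))"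
    using sum_even_choose_golden_powi[OF golden_roots(2), folded defs, of n s]
    unfolding S_def u_def v_def rel .
  define SF SL where
    "SF = 2 * (\<Sum>k = 0..n div 2. real (n choose (2 * k)) *
              (real_of_int (fibonacci (6 * int k + s)) / 9 ^ k))" and
    "SL = 2 * (\<Sum>k = 0..n div 2. real (n choose (2 * k)) *
              (real_of_int (lucas (6 * int k + s)) / 9 ^ k))"
  have "sqrt 5 * SF = 2 * (\<Sum>k = 0..n div 2. real (n choose (2 * k)) *
              (sqrt 5 * real_of_int (fibonacci (6 * int k + s)) / 9 ^ k))"
    by (simp add: SF_def sum_distrib_left mult_ac)
  then have SF: "sqrt 5 * SF = S \<alpha> - S \<beta>"
    unfolding F S_def
    by (simp add: sum_subtractf diff_divide_distrib right_diff_distrib)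
  have SL: "SL = S \<alpha> + S \<beta>"
    unfolding SL_def L S_def
    by (simp add: sum.distrib add_divide_distrib distrib_left)
  have u1: "(-1 :: real) powi (s + 1) = - u"
    by (simp add: u_def power_int_add)
  \<comment> \<open>With the four powers as atoms, only identities linear in them remain, with
    coefficients built from \<open>u\<close>, \<open>v\<close> and powers of
    \<open>sqrt 5\<close>.\<close>
  define a b c d where "a = \<alpha> powi (int n + s)" and "b = \<beta> powi (int n + s)"
    and "c = \<alpha> powi (int n - s)" and "d = \<beta> powi (int n - s)"
  note abcd = a_def[symmetric] b_def[symmetric] c_def[symmetric] d_def[symmetric]
  have Fp: "real_of_int (fibonacci (int n + s)) = (a - b) / sqrt 5"
    and Fm: "real_of_int (fibonacci (int n - s)) = (c - d) / sqrt 5"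
    using F[of "int n + s"] F[of "int n - s"] unfolding abcd by (simp_all add: field_simps)
  have SF': "SF = (S \<alpha> - S \<beta>) / sqrt 5"
    using SF by (simp add: field_simps)
  have sqrt5: "sqrt 5 * (sqrt 5 * t) = 5 * t" for t
    by (simp flip: mult.assoc)
  have "SF = v * (if even n
            then - u * ((c - d) / sqrt 5) + 5 ^ (n div 2) * ((a - b) / sqrt 5)
            else - u * ((c - d) / sqrt 5) + 5 ^ ((n - 1) div 2) * (a + b))
       \<and> SL = v * (if even n
            then u * (c + d) + 5 ^ (n div 2) * (a + b)
            else u * (c + d) + 5 ^ ((n + 1) div 2) * ((a - b) / sqrt 5))"
  \<comment> \<open>For even \<open>n\<close>, \<open>sqrt 5 ^ n\<close> and
    \<open>(- sqrt 5) ^ n\<close> coincide, so \<open>a\<close> and \<open>b\<close> enter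
    \<open>SF\<close> as \<open>a - b\<close> and \<open>SL\<close> as \<open>a + b\<close>. For odd
    \<open>n\<close> they are opposite, which swaps Fibonacci and Lucas in these terms.\<close>
  proof (cases "even n")
    case True
    then obtain m where m: "n = 2 * m" by blast
    show ?thesis
      unfolding SF' SL S\<alpha> S\<beta> abcd using True
      by (simp add: m power_mult) (simp add: field_simps sqrt5)
  next
    case False
    then obtain m where m: "n = 2 * m + 1" by (blast elim: oddE)
    \<comment> \<open>Here \<open>(n + 1) div 2\<close> is \<open>m + 1\<close>, and the extra
      factor 5 divided by \<open>sqrt 5\<close> leaves \<open>sqrt 5\<close>.\<close>
    have "5 ^ ((n + 1) div 2) * ((a - b) / sqrt 5) = 5 ^ m * (sqrt 5 * (a - b))"
      by (simp add: m field_simps sqrt5)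
    moreover have "(n - 1) div 2 = m"
      by (simp add: m)
    moreover have "SF = v * (- u * ((c - d) / sqrt 5) + 5 ^ m * (a + b))"
      unfolding SF' S\<alpha> S\<beta> abcd by (simp add: m power_mult) (simp add: field_simps)
    moreover have "SL = v * (u * (c + d) + 5 ^ m * (sqrt 5 * (a - b)))"
      unfolding SL S\<alpha> S\<beta> abcd by (simp add: m power_mult) (simp add: algebra_simps)
    ultimately show ?thesis
      using False by presburger
  qed
  then show ?thesis
    unfolding SF_def[symmetric] SL_def[symmetric] u1 Fp Fm L[of "int n + s"] L[of "int n - s"] abcd
    unfolding u_def[symmetric] v_def[symmetric] .
qed

end
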